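(* Let $m$ be an integer with $m\le n$, and consider the BFGS method started at step $m$ as described in the context. If $\mathrm{rank}(\tilde S_m)=m$, then for all $k\ge m$ and any objective function, there exists an $m\times m$ matrix $\hat L_{k-1}$ such that $$H_k=\tilde S_k\hat L_{k-1}\tilde S_k^T,$$ if and only if $$\mathrm{rank}(\tilde S_k)\equiv m,\qquad k\ge m.$$
   Context: For a differentiable objective function $f:\mathbb{R}^n\to\mathbb{R}$, let $(\boldsymbol x_k)_{k\ge0}$ be the iterates in $\mathbb{R}^n$, and write $\nabla f_k=\nabla f(\boldsymbol x_k)$. Put $\boldsymbol s_k=\boldsymbol x_{k+1}-\boldsymbol x_k$, $\boldsymbol y_k=\nabla f_{k+1}-\nabla f_k$, $\tilde{\boldsymbol s}_k=\boldsymbol s_k/\sqrt{\boldsymbol s_k^T\boldsymbol y_k}$ and $\tilde{\boldsymbol y}_k=\boldsymbol y_k/\sqrt{\boldsymbol s_k^T\boldsymbol y_k}$, where $\boldsymbol s_k^T\boldsymbol y_k>0$ for all $k$ so that these are defined. $S_k=[\tilde{\boldsymbol s}_0\ \cdots\ \tilde{\boldsymbol s}_{k-1}]\in\mathbb{R}^{n\times k}$, and for $k\ge m$, $\tilde S_k=[\tilde{\boldsymbol s}_{k-m}\ \cdots\ \tilde{\boldsymbol s}_{k-1}]\in\mathbb{R}^{n\times m}$ (so $\tilde S_m=S_m$). BFGS method started at step $m$: the points $\boldsymbol x_0,\dots,\boldsymbol x_m$ are given, $H_m=S_mL_{m-1}S_m^T$ with $L_{m-1}$ an $m\times m$ matrix,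 and for $k\ge m$ the step is taken along the search direction $-H_k\nabla f_k$, i.e. $\boldsymbol x_{k+1}=\boldsymbol x_k-\tau_kH_k\nabla f_k$ with a step length $\tau_k\in\mathbb{R}$ (no particular step-length rule is specified), and $$H_{k+1}=(I-\tilde{\boldsymbol s}_k\tilde{\boldsymbol y}_k^T)H_k(I-\tilde{\boldsymbol s}_k\tilde{\boldsymbol y}_k^T)^T+\tilde{\boldsymbol s}_k\tilde{\boldsymbol s}_k^T.$$
   Formalization: The "only if" direction (representation implies rank m) is proved assuming L_{m-1} is positive definite (vᵀLv > 0 for v ≠ 0, symmetry not needed), since it fails for arbitrary L_{m-1}; the "if" direction is proved for every L_{m-1}. *)

theory Defs
  imports "HOL-Analysis.Analysis"
begin

definition grad :: "(real ^ 'n \<Rightarrow> real) \<Rightarrow> real ^ 'n \<Rightarrow> real ^ 'n" where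
  "grad f a = (\<chi> i. frechet_derivative f (at a) (axis i 1))"

definition outer :: "real ^ 'a \<Rightarrow> real ^ 'b \<Rightarrow> real ^ 'b ^ 'a" where
  "outer u v = (\<chi> i j. u $ i * v $ j)"

definition step :: "(nat \<Rightarrow> real ^ 'n) \<Rightarrow> nat \<Rightarrow> real ^ 'n" where
  "step x k = x (Suc k) - x k"

definition gdiff :: "(real ^ 'n \<Rightarrow> real) \<Rightarrow> (nat \<Rightarrow> real ^ 'n) \<Rightarrow> nat \<Rightarrow> real ^ 'n" where
  "gdiff f x k = grad f (x (Suc k)) - grad f (x k)"

definition nstep :: "(real ^ 'n \<Rightarrow> real) \<Rightarrow> (nat \<Rightarrow> real ^ 'n) \<Rightarrow> nat \<Rightarrow> real ^ 'n" where
  "nstep f x k = step x k /\<^sub>R sqrt (step x k \<bullet> gdiff f x k)"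

definition ngdiff :: "(real ^ 'n \<Rightarrow> real) \<Rightarrow> (nat \<Rightarrow> real ^ 'n) \<Rightarrow> nat \<Rightarrow> real ^ 'n" where
  "ngdiff f x k = gdiff f x k /\<^sub>R sqrt (step x k \<bullet> gdiff f x k)"

(* The column indices are an arbitrary finite linear order of size m; an index is
   identified with its position in {0..<m}. *)
definition pos :: "'m::{finite,linorder} \<Rightarrow> nat" where
  "pos j = card {i. i < j}"

(* Columns nstep (k - m), ..., nstep (k - 1) in this order, where m = CARD('m).
   Only meaningful for k \<ge> m, since the subtraction is on nat. *)
definition Smat ::
  "(real ^ 'n \<Rightarrow> real) \<Rightarrow> (nat \<Rightarrow> real ^ 'n) \<Rightarrow> nat \<Rightarrow> real ^ 'm::{finite,linorder} ^ 'n" where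
  "Smat f x k = (\<chi> i j. nstep f x (k - CARD('m) + pos j) $ i)"

(* Symmetry is deliberately not part of this notion. *)
definition pos_def_mat :: "real ^ 'm ^ 'm \<Rightarrow> bool" where
  "pos_def_mat A \<longleftrightarrow> (\<forall>v. v \<noteq> 0 \<longrightarrow> 0 < v \<bullet> (A *v v))"

end

theory Submission
  imports Defs
begin

text \<open>
  Write \<open>m = CARD('m)\<close> and let \<open>W\<close> be the column space of \<open>S m\<close>, so \<open>dim W = m\<close>. The
  proof compares the column space of every \<open>S k\<close> with this one fixed subspace.

  First, \<open>W\<close> is never left. If \<open>H k\<close> and its transpose map into \<open>W\<close>, then the new step, a
  multiple of \<open>H k *v grad f (x k)\<close>, lies in \<open>W\<close>, and the update only adds multiples of
  this step, so \<open>H (Suc k)\<close> and its transpose map into \<open>W\<close> again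
  (\<open>bfgs_iterates_in_subspace\<close>). Hence the columns of every \<open>S k\<close> lie in \<open>W\<close>. If
  \<open>rank (S k) = m\<close>, they span \<open>W\<close>, and a matrix whose column and row spaces lie in the column
  space of \<open>S k\<close> factors through \<open>S k\<close> on both sides (\<open>two_sided_factorization\<close>).

  Second, if \<open>L\<close> is positive definite, the quadratic form of \<open>H k\<close> is nonnegative and vanishes
  at most on the orthogonal complement of \<open>W\<close>: an update adds the square \<open>(s \<bullet> v)\<^sup>2\<close>, and
  where this square is zero it leaves the argument of the old form unchanged
  (\<open>bfgs_update_vanishing\<close>). A factorization through \<open>S k\<close> makes the form vanish on the
  orthogonal complement of the columns of \<open>S k\<close>, so that complement is contained in the
  one of \<open>W\<close>, and \<open>rank (S k) \<ge> m\<close>.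
\<close>

section \<open>Factorization through a column space\<close>

(* The rewriting of transpose A *v x to x v* A would hide the products with a transpose. *)
declare transpose_matrix_vector [simp del]

lemma outer_vector_mult: "outer s y *v u = (y \<bullet> u) *\<^sub>R s"
  by (simp add: outer_def matrix_vector_mult_def inner_vec_def vec_eq_iff
      sum_distrib_left mult_ac)

lemma transpose_outer: "transpose (outer s y) = outer y s"
  by (simp add: outer_def transpose_def vec_eq_iff mult.commute)

lemma transpose_add: "transpose (A + B) = transpose A + transpose B"
  for A B :: "real ^ 'a ^ 'b"
  by (simp add: transpose_def vec_eq_iff)

lemma transpose_diff: "transpose (A - B) = transpose A - transpose B"
  for A B :: "real ^ 'a ^ 'b"
  by (simp add: transpose_def vec_eq_iff)

lemma subspace_range_matrix: "subspace (range ((*v) S))"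
  for S :: "real ^ 'm ^ 'n"
  by (intro linear_subspace_image matrix_vector_mul_linear subspace_UNIV)

lemma range_matrix_subset:
  fixes S :: "real ^ 'm ^ 'n"
  assumes "subspace W" and "\<And>j. column j S \<in> W"
  shows "range ((*v) S) \<subseteq> W"
proof
  fix w assume "w \<in> range ((*v) S)"
  then obtain u where "w = S *v u" by auto
  then have "w = (\<Sum>j\<in>UNIV. u $ j *\<^sub>R column j S)"
    by (simp add: matrix_mult_sum scalar_mult_eq_scaleR)
  then show "w \<in> W"
    using assms by (simp add: subspace_sum subspace_scale)
qed

lemma matrix_right_inverse_on_range:
  fixes S :: "real ^ 'm ^ 'n"
  shows "\<exists>G. \<forall>w \<in> range ((*v) S). S *v (G *v w) = w"
proof -
  obtain g where "linear g" "\<forall>w \<in> range ((*v) S). S *v g w = w"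
    using real_vector.linear_exists_right_inverse_on[OF matrix_vector_mul_linear subspace_UNIV, of S]
    by auto
  then have "\<forall>w \<in> range ((*v) S). S *v (matrix g *v w) = w"
    by (simp add: matrix_works)
  then show ?thesis by blast
qed

text \<open>
  A right inverse \<open>G\<close> of \<open>S\<close> on its column space makes \<open>S ** G\<close> fix that space pointwise; the two
  hypotheses then give \<open>A = S ** G ** A\<close> and the same for the transpose, so the middle factor can
  be taken to be \<open>G ** A ** transpose G\<close>.
\<close>

lemma two_sided_factorization:
  fixes A :: "real ^ 'n ^ 'n" and S :: "real ^ 'm ^ 'n"
  assumes A: "\<And>u. A *v u \<in> range ((*v) S)"
    and At: "\<And>u. transpose A *v u \<in> range ((*v) S)"
  shows "\<exists>M. A = S ** M ** transpose S"
proof -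
  obtain G where fix_range: "\<And>w. w \<in> range ((*v) S) \<Longrightarrow> S *v (G *v w) = w"
    using matrix_right_inverse_on_range[of S] by blast
  have 1: "S ** G ** A = A"
    by (simp add: matrix_eq fix_range[OF A] flip: matrix_vector_mul_assoc)
  have "S ** G ** transpose A = transpose A"
    by (simp add: matrix_eq fix_range[OF At] flip: matrix_vector_mul_assoc)
  then have 2: "A ** transpose G ** transpose S = A"
    by (metis matrix_transpose_mul matrix_mul_assoc transpose_transpose)
  have "A = S ** (G ** A ** transpose G) ** transpose S"
    using 1 2 by (metis matrix_mul_assoc)
  then show ?thesis by blast
qed

text \<open>
  If the kernel of \<open>transpose T\<close> is contained in that of \<open>transpose S\<close>, then \<open>transpose S\<close> is
  determined by the values of \<open>transpose T\<close>, that is, \<open>transpose S = X ** transpose T\<close> for some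
  \<open>X\<close>; a product has at most the rank of its factors.
\<close>

lemma rank_le_if_transpose_kernel_subset:
  fixes S T :: "real ^ 'm ^ 'n"
  assumes "\<And>v. transpose T *v v = 0 \<Longrightarrow> transpose S *v v = 0"
  shows "rank S \<le> rank T"
proof -
  obtain G where G: "\<And>w. w \<in> range ((*v) (transpose T)) \<Longrightarrow> transpose T *v (G *v w) = w"
    using matrix_right_inverse_on_range[of "transpose T"] by blast
  have "(transpose S ** G) ** transpose T = transpose S"
  proof (subst matrix_eq, rule allI)
    fix v
    have "transpose T *v (G *v (transpose T *v v) - v) = 0"
      by (simp add: matrix_vector_mult_diff_distrib G)
    then have "transpose S *v (G *v (transpose T *v v) - v) = 0"
      by (rule assms)
    then show "((transpose S ** G) ** transpose T) *v v = transpose S *v v"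
      by (simp add: matrix_vector_mult_diff_distrib flip: matrix_vector_mul_assoc)
  qed
  then have "rank (transpose S) \<le> rank (transpose T)"
    by (metis rank_mul_le_right)
  then show ?thesis by (simp add: rank_transpose)
qed

lemma inner_factorized:
  fixes S :: "real ^ 'm ^ 'n"
  shows "v \<bullet> ((S ** M ** transpose S) *v v)
    = (transpose S *v v) \<bullet> (M *v (transpose S *v v))"
  by (metis dot_lmul_matrix matrix_vector_mul_assoc transpose_matrix_vector)

section \<open>The BFGS update\<close>

definition bfgs_update ::
  "real ^ 'n \<Rightarrow> real ^ 'n \<Rightarrow> real ^ 'n ^ 'n \<Rightarrow> real ^ 'n ^ 'n" where
  "bfgs_update s y A =
     (mat 1 - outer s y) ** A ** transpose (mat 1 - outer s y) + outer s s"

lemma bfgs_update_vector_mult: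
  "bfgs_update s y A *v u
     = A *v (u - (s \<bullet> u) *\<^sub>R y) - (y \<bullet> (A *v (u - (s \<bullet> u) *\<^sub>R y))) *\<^sub>R s + (s \<bullet> u) *\<^sub>R s"
  unfolding bfgs_update_def
  by (simp add: transpose_diff transpose_outer outer_vector_mult matrix_vector_mult_add_rdistrib
      matrix_vector_mult_diff_rdistrib flip: matrix_vector_mul_assoc)

lemma transpose_bfgs_update: "transpose (bfgs_update s y A) = bfgs_update s y (transpose A)"
  unfolding bfgs_update_def
  by (simp add: transpose_add transpose_outer matrix_transpose_mul matrix_mul_assoc)

lemma bfgs_update_in_subspace:
  assumes "subspace W" and "\<And>u. A *v u \<in> W" and "s \<in> W"
  shows "bfgs_update s y A *v u \<in> W"
  unfolding bfgs_update_vector_mult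
  using assms by (intro subspace_add subspace_diff subspace_scale)

lemma bfgs_update_quadratic_form:
  "v \<bullet> (bfgs_update s y A *v v)
     = (v - (s \<bullet> v) *\<^sub>R y) \<bullet> (A *v (v - (s \<bullet> v) *\<^sub>R y)) + (s \<bullet> v)\<^sup>2"
  unfolding bfgs_update_vector_mult
  by (simp add: inner_diff_left inner_add_right inner_diff_right inner_commute power2_eq_square
      mult.commute)

text \<open>
  The new form is a value of the old one plus a square, so both summands must vanish. The square
  is \<open>(s \<bullet> v)\<^sup>2\<close>, and \<open>s \<bullet> v = 0\<close> turns the argument of the old form into \<open>v\<close> itself.
\<close>

lemma bfgs_update_vanishing:
  assumes nonneg: "\<And>v. 0 \<le> v \<bullet> (A *v v)"
    and zero: "v \<bullet> (bfgs_update s y A *v v) = 0"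
  shows "v \<bullet> (A *v v) = 0"
proof -
  have "s \<bullet> v = 0"
    using zero nonneg[of "v - (s \<bullet> v) *\<^sub>R y"]
    by (simp add: bfgs_update_quadratic_form add_nonneg_eq_0_iff)
  then show ?thesis
    using zero by (simp add: bfgs_update_quadratic_form)
qed

lemma bfgs_iterates_vanishing:
  assumes upd: "\<And>k. m \<le> k \<Longrightarrow> H (Suc k) = bfgs_update (s k) (y k) (H k)"
    and nonneg: "\<And>v. 0 \<le> v \<bullet> (H m *v v)"
    and "m \<le> k"
  shows "0 \<le> v \<bullet> (H k *v v) \<and> (v \<bullet> (H k *v v) = 0 \<longrightarrow> v \<bullet> (H m *v v) = 0)"
  using \<open>m \<le> k\<close>
proof (induction k arbitrary: v rule: dec_induct)
  case base
  then show ?case using nonneg by simp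
next
  case (step k)
  have H: "H (Suc k) = bfgs_update (s k) (y k) (H k)"
    using upd step.hyps(1) .
  have IH: "0 \<le> w \<bullet> (H k *v w)" "w \<bullet> (H k *v w) = 0 \<Longrightarrow> w \<bullet> (H m *v w) = 0" for w
    using step.IH by blast+
  have "0 \<le> v \<bullet> (H (Suc k) *v v)"
    unfolding H bfgs_update_quadratic_form by (intro add_nonneg_nonneg IH(1) zero_le_power2)
  moreover have "v \<bullet> (H m *v v) = 0" if "v \<bullet> (H (Suc k) *v v) = 0"
    using IH(2) bfgs_update_vanishing[OF IH(1)] that unfolding H by blast
  ultimately show ?case by blast
qed

text \<open>
  The transpose is carried along because a two-sided factorization constrains the row space as well;
  \<open>H m\<close> need not be symmetric.
\<close>

lemma bfgs_iterates_in_subspace: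
  assumes "subspace W"
    and upd: "\<And>k. m \<le> k \<Longrightarrow> H (Suc k) = bfgs_update (s k) (y k) (H k)"
    and s: "\<And>k. m \<le> k \<Longrightarrow> \<exists>c u. s k = c *\<^sub>R (H k *v u)"
    and H: "\<And>u. H m *v u \<in> W" and Ht: "\<And>u. transpose (H m) *v u \<in> W"
    and "m \<le> k"
  shows "H k *v u \<in> W \<and> transpose (H k) *v u \<in> W \<and> s k \<in> W"
proof -
  have in_W: "s k \<in> W" if "m \<le> k" "\<And>u. H k *v u \<in> W" for k
    using s[OF that(1)] that(2) \<open>subspace W\<close> by (metis subspace_scale)
  have "\<forall>u. H k *v u \<in> W \<and> transpose (H k) *v u \<in> W"
    using \<open>m \<le> k\<close>
  proof (induction k rule: dec_induct)
    case base
    then show ?case using H Ht by simp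
  next
    case (step k)
    then have "s k \<in> W" using in_W by simp
    then show ?case
      using step \<open>subspace W\<close>
      by (simp add: upd transpose_bfgs_update bfgs_update_in_subspace)
  qed
  then show ?thesis using in_W \<open>m \<le> k\<close> by blast
qed

section \<open>The window of normalized steps\<close>

lemma pos_less_card: "pos j < CARD('m)"
  for j :: "'m::{finite,linorder}"
  unfolding pos_def by (rule psubset_card_mono) auto

text \<open>
  An injection of a set of size \<open>m\<close> into \<open>{..<m}\<close> is onto. This guarantees that no step of the
  window is missing among the columns.
\<close>

lemma range_pos: "range (pos :: 'm \<Rightarrow> nat) = {..<CARD('m::{finite,linorder})}"
proof -
  have "pos i < pos j" if "i < j" for i j :: 'm
    unfolding pos_def using that by (intro psubset_card_mono) auto
  then have "inj (pos :: 'm \<Rightarrow> nat)"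
    by (intro strict_mono_imp_inj_on) (simp add: strict_mono_def)
  then show ?thesis
    by (intro card_subset_eq) (auto simp: pos_less_card card_image)
qed

lemma column_Smat:
  "column j (Smat f x k :: real ^ 'm::{finite,linorder} ^ 'n) = nstep f x (k - CARD('m) + pos j)"
  by (simp add: column_def Smat_def vec_eq_iff)

lemma nstep_in_first_window:
  fixes f :: "real ^ 'n \<Rightarrow> real"
  assumes "i < CARD('m::{finite,linorder})"
  shows "nstep f x i \<in>
    range ((*v) (Smat f x CARD('m) :: real ^ 'm::{finite,linorder} ^ 'n))"
proof -
  obtain j :: 'm where "pos j = i"
    using assms range_pos[where 'm = 'm] by (metis imageE lessThan_iff)
  then have "nstep f x i = column j (Smat f x CARD('m) :: real ^ 'm::{finite,linorder} ^ 'n)"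
    by (simp add: column_Smat)
  then show ?thesis
    by (metis matrix_vector_mult_basis rangeI)
qed

section \<open>Preservation of the factored form\<close>

theorem theorem3:
  fixes f :: "real ^ 'n \<Rightarrow> real"
    and x :: "nat \<Rightarrow> real ^ 'n"
    and \<tau> :: "nat \<Rightarrow> real"
    and H :: "nat \<Rightarrow> real ^ 'n ^ 'n"
    and S :: "nat \<Rightarrow> real ^ 'm::{finite,linorder} ^ 'n"
    and L :: "real ^ 'm::{finite,linorder} ^ 'm::{finite,linorder}"
  assumes "CARD('m) \<le> CARD('n)"
    and "\<And>a. f differentiable (at a)"
    and "\<And>k. 0 < step x k \<bullet> gdiff f x k"
    and "S = Smat f x"
    and "H CARD('m) = S CARD('m) ** L ** transpose (S CARD('m))"
    and "\<And>k. CARD('m) \<le> k \<Longrightarrow> x (Suc k) = x k - \<tau> k *\<^sub>R (H k *v grad f (x k))"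
    and "\<And>k. CARD('m) \<le> k \<Longrightarrow>
           H (Suc k) =
             (mat 1 - outer (nstep f x k) (ngdiff f x k)) ** H k
               ** transpose (mat 1 - outer (nstep f x k) (ngdiff f x k))
             + outer (nstep f x k) (nstep f x k)"
    and "rank (S CARD('m)) = CARD('m)"
  shows
    "(pos_def_mat L \<longrightarrow>
       ((\<forall>k \<ge> CARD('m). \<exists>Lh. H k = S k ** Lh ** transpose (S k))
         \<longleftrightarrow> (\<forall>k \<ge> CARD('m). rank (S k) = CARD('m))))
     \<and>
     ((\<forall>k \<ge> CARD('m). rank (S k) = CARD('m))
       \<longrightarrow> (\<forall>k \<ge> CARD('m). \<exists>Lh. H k = S k ** Lh ** transpose (S k)))"
proof -
  define W where "W = range ((*v) (S CARD('m)))"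
  have W: "subspace W"
    unfolding W_def by (rule subspace_range_matrix)
  have upd: "H (Suc k) = bfgs_update (nstep f x k) (ngdiff f x k) (H k)" if "CARD('m) \<le> k" for k
    using assms(7)[OF that] by (simp add: bfgs_update_def)
  have dir: "\<exists>c u. nstep f x k = c *\<^sub>R (H k *v u)" if "CARD('m) \<le> k" for k
  proof -
    have "step x k = (- \<tau> k) *\<^sub>R (H k *v grad f (x k))"
      using assms(6)[OF that] by (simp add: step_def)
    then show ?thesis
      unfolding nstep_def by (metis scaleR_scaleR)
  qed
  have base: "H CARD('m) *v u \<in> W" "transpose (H CARD('m)) *v u \<in> W" for u
    unfolding W_def assms(5)
    by (simp_all add: matrix_transpose_mul flip: matrix_vector_mul_assoc)
  have in_W: "H k *v u \<in> W \<and> transpose (H k) *v u \<in> W \<and> nstep f x k \<in> W"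
    if "CARD('m) \<le> k" for k u
    by (rule bfgs_iterates_in_subspace[where H = H and y = "ngdiff f x", OF W])
      (fact upd dir base that)+
  have steps: "nstep f x i \<in> W" for i
  proof (cases "i < CARD('m)")
    case True
    then show ?thesis
      using nstep_in_first_window unfolding W_def assms(4) by blast
  next
    case False
    then show ?thesis using in_W[of i] by simp
  qed
  have backward: "\<exists>Lh. H k = S k ** Lh ** transpose (S k)"
    if k: "CARD('m) \<le> k" and rank: "rank (S k) = CARD('m)" for k
  proof -
    have "range ((*v) (S k)) \<subseteq> W"
      by (rule range_matrix_subset[OF W]) (simp add: assms(4) column_Smat steps)
    moreover have "dim W \<le> dim (range ((*v) (S k)))"
      unfolding W_def using rank assms(8) by (simp add: rank_dim_range)
    ultimately have "range ((*v) (S k)) = W"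
      using subspace_dim_equal[OF subspace_range_matrix W] by blast
    then show ?thesis
      using two_sided_factorization in_W[OF k] by metis
  qed
  have forward: "rank (S k) = CARD('m)"
    if L: "pos_def_mat L" and k: "CARD('m) \<le> k"
      and fact: "H k = S k ** Lh ** transpose (S k)" for k Lh
  proof -
    have "0 \<le> w \<bullet> (L *v w)" for w
      using L by (cases "w = 0") (auto simp: pos_def_mat_def less_imp_le)
    then have nonneg: "0 \<le> v \<bullet> (H CARD('m) *v v)" for v
      unfolding assms(5) inner_factorized by blast
    have vanishing: "0 \<le> v \<bullet> (H k *v v) \<and> (v \<bullet> (H k *v v) = 0 \<longrightarrow> v \<bullet> (H CARD('m) *v v) = 0)" for v
      by (rule bfgs_iterates_vanishing[where s = "nstep f x" and y = "ngdiff f x"])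
        (fact upd nonneg k)+
    have "transpose (S CARD('m)) *v v = 0" if "transpose (S k) *v v = 0" for v
    proof -
      have "v \<bullet> (H k *v v) = 0"
        unfolding fact inner_factorized that by simp
      then have "v \<bullet> (H CARD('m) *v v) = 0"
        using vanishing by blast
      then show ?thesis
        using L unfolding assms(5) inner_factorized pos_def_mat_def by (metis less_irrefl)
    qed
    then have "rank (S CARD('m)) \<le> rank (S k)"
      by (rule rank_le_if_transpose_kernel_subset)
    moreover have "rank (S k) \<le> CARD('m)"
      using rank_bound[of "S k"] by simp
    ultimately show ?thesis
      using assms(8) by simp
  qed
  show ?thesis
    using backward forward by blast
qed

end
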